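(* Let $k\ge1$, let $a_i,b_i,c_i$ ($i\in\mathbb{Z}$) be real and $k$-periodic in $i$ with $b_ic_i>0$ for $1\le i\le k$ and $\prod_{i=1}^k\frac{b_i}{c_i}>1$, and let $f$ be the associated symbol. Let $\mathbf{L}(f)$ be the associated tridiagonal $k$-Laurent operator with a defect at site $m$. Let $\lambda\in\sigma_{\mathrm{wind}}^{\mathsf c}=\mathbb{R}\setminus\sigma_{\mathrm{wind}}$ and let $\mathbf{u}$ be an eigenvector of the defected operator $\mathbf{L}(f)$ with eigenvalue $\lambda$. Then the entries of $\mathbf{u}$ decay exponentially: (i) leading up to the defect site, that is, for $i\le m$, $$\frac{|\mathbf{u}^{(i+k)}|}{|\mathbf{u}^{(i)}|}=e^{-(r-\tilde\beta)};$$ (ii) past the defect site, that is, for $i\ge m$, $$\frac{|\mathbf{u}^{(i+k)}|}{|\mathbf{u}^{(i)}|}=e^{-(r+\tilde\beta)}.$$ In both cases $r=\frac12\log\bigl(\prod_{i=1}^k\frac{b_i}{c_i}\bigr)$ is fixed and $\tilde\beta=\tilde\beta(\lambda)=\operatorname{arccosh}\bigl(-\frac{g(\lambda)}{2Ae^{r}}\bigr)$ depends on the eigenvalue $\lambda$, the positive root of $\operatorname{arccosh}$ being chosen.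
   Context: The (pristine) tridiagonal $k$-Laurent operator is the doubly infinite tridiagonal matrix indexed by $\mathbb{Z}$ with entries $a_i$ at $(i,i)$, $b_i$ at $(i,i+1)$ and $c_i$ at $(i+1,i)$. The operator with a defect at site $m$ is obtained from it by perturbing the entries of the row of index $m$; all other rows are unchanged. Let $\mathbf{A}_0$ be the $k\times k$ tridiagonal matrix with diagonal $a_1,\dots,a_k$, superdiagonal $b_1,\dots,b_{k-1}$, subdiagonal $c_1,\dots,c_{k-1}$; let $\mathbf{A}_{-1}$ be the $k\times k$ matrix with single nonzero entry $b_k$ in position $(k,1)$, and $\mathbf{A}_1$ the one with single nonzero entry $c_k$ in position $(1,k)$ (for $k=1$ these are the scalars $a_1,b_1,c_1$). The symbol is $f(z)=\mathbf{A}_{-1}z^{-1}+\mathbf{A}_0+\mathbf{A}_1z$. Notation: $A=(-1)^{k+1}\prod_{i=1}^kc_i$, and $g(\lambda)=\det(\mathbf{A}_0-\lambda\,\mathrm{Id})-b_kc_k\,p(\lambda)$, where $p=0$ if $k=1$, $p=1$ if $k=2$, and for $k\ge3$ $p(\lambda)$ is the determinant of the submatrix of $\mathbf{A}_0-\lambda\,\mathrm{Id}$ formed by rows and columns $2,\dots,k-1$. (Thus $\det(f(z)-\lambda\,\mathrm{Id})=Az+Bz^{-1}+g(\lambda)$ with $B=(-1)^{k+1}\prod_{i=1}^k b_i$.) The winding region $\sigma_{\mathrm{wind}}$ is the set of $\lambda\in\mathbb{R}$ such that the closed curve $\theta\mapsto\det(f(e^{-\mathrm{i}\theta})-\lambda\,\mathrm{Id})$,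 $\theta$ from $0$ to $2\pi$, has winding number $>0$ around $0$.
   Formalization: Part (i) is stated for i+k ≤ m, since (i) and (ii) contradict each other at i = m when the entry is nonzero; where u^{(i)} = 0 the claim is u^{(i+k)} = 0; for a negative argument the real part of the principal complex arccosh is taken. *)

theory Defs
  imports
    "HOL-Complex_Analysis.Winding_Numbers"
    "Jordan_Normal_Form.Determinant"
begin

hide_const (open) Determinants.det

text \<open>
  Matrices are those of Jordan_Normal_Form, hence indexed from 0: the entry in position
  \<open>(i, j)\<close> of the mathematics is the entry \<open>(i - 1, j - 1)\<close> here. The coefficient sequences
  \<open>a, b, c\<close> keep their own indices.
\<close>

section \<open>The symbol\<close>

definition A_zero :: "nat \<Rightarrow> (int \<Rightarrow> real) \<Rightarrow> (int \<Rightarrow> real) \<Rightarrow> (int \<Rightarrow> real) \<Rightarrow> real mat" where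
  "A_zero k a b c = mat k k (\<lambda>(i, j).
     if i = j then a (int i + 1)
     else if j = i + 1 then b (int i + 1)
     else if i = j + 1 then c (int j + 1)
     else 0)"

definition A_minus :: "nat \<Rightarrow> (int \<Rightarrow> real) \<Rightarrow> real mat" where
  "A_minus k b = mat k k (\<lambda>(i, j). if i = k - 1 \<and> j = 0 then b (int k) else 0)"

definition A_plus :: "nat \<Rightarrow> (int \<Rightarrow> real) \<Rightarrow> real mat" where
  "A_plus k c = mat k k (\<lambda>(i, j). if i = 0 \<and> j = k - 1 then c (int k) else 0)"

definition symbol ::
  "nat \<Rightarrow> (int \<Rightarrow> real) \<Rightarrow> (int \<Rightarrow> real) \<Rightarrow> (int \<Rightarrow> real) \<Rightarrow> complex \<Rightarrow> complex mat" where
  "symbol k a b c z =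
     inverse z \<cdot>\<^sub>m map_mat complex_of_real (A_minus k b)
     + map_mat complex_of_real (A_zero k a b c)
     + z \<cdot>\<^sub>m map_mat complex_of_real (A_plus k c)"

text \<open>The closed curve \<open>\<theta> \<mapsto> det (f (exp (- \<i> \<theta>)) - \<lambda> Id)\<close>, with \<open>\<theta> = 2 pi t\<close> and \<open>0 \<le> t \<le> 1\<close>.\<close>

definition symbol_curve ::
  "nat \<Rightarrow> (int \<Rightarrow> real) \<Rightarrow> (int \<Rightarrow> real) \<Rightarrow> (int \<Rightarrow> real) \<Rightarrow> real \<Rightarrow> real \<Rightarrow> complex" where
  "symbol_curve k a b c lam t =
     Determinant.det (symbol k a b c (exp (- \<i> * complex_of_real (2 * pi * t)))
       - complex_of_real lam \<cdot>\<^sub>m 1\<^sub>m k)"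

text \<open>
  A curve through 0 has no winding number around 0, whereas \<^const>\<open>winding_number\<close> returns an
  unspecified value there; such \<open>\<lambda>\<close> therefore have to be excluded explicitly. Away from the curve
  the winding number is an integer, given as a complex number.
\<close>

definition sigma_wind ::
  "nat \<Rightarrow> (int \<Rightarrow> real) \<Rightarrow> (int \<Rightarrow> real) \<Rightarrow> (int \<Rightarrow> real) \<Rightarrow> real set" where
  "sigma_wind k a b c =
     {lam. 0 \<notin> path_image (symbol_curve k a b c lam)
           \<and> Re (winding_number (symbol_curve k a b c lam) 0) > 0}"

section \<open>The decay rates\<close>

definition p_minor :: "nat \<Rightarrow> (int \<Rightarrow> real) \<Rightarrow> (int \<Rightarrow> real) \<Rightarrow> (int \<Rightarrow> real) \<Rightarrow> real \<Rightarrow> real" where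
  "p_minor k a b c lam =
     (if k = 1 then 0
      else if k = 2 then 1
      else Determinant.det (mat (k - 2) (k - 2)
             (\<lambda>(i, j). (A_zero k a b c - lam \<cdot>\<^sub>m 1\<^sub>m k) $$ (i + 1, j + 1))))"

definition g_symbol :: "nat \<Rightarrow> (int \<Rightarrow> real) \<Rightarrow> (int \<Rightarrow> real) \<Rightarrow> (int \<Rightarrow> real) \<Rightarrow> real \<Rightarrow> real" where
  "g_symbol k a b c lam =
     Determinant.det (A_zero k a b c - lam \<cdot>\<^sub>m 1\<^sub>m k) - b (int k) * c (int k) * p_minor k a b c lam"

definition A_coeff :: "nat \<Rightarrow> (int \<Rightarrow> real) \<Rightarrow> real" where
  "A_coeff k c = (- 1) ^ (k + 1) * (\<Prod>i = 1..k. c (int i))"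

definition decay_r :: "nat \<Rightarrow> (int \<Rightarrow> real) \<Rightarrow> (int \<Rightarrow> real) \<Rightarrow> real" where
  "decay_r k b c = 1 / 2 * ln (\<Prod>i = 1..k. b (int i) / c (int i))"

text \<open>
  The principal branch of the complex inverse hyperbolic cosine, which has nonnegative real part.
  The constant \<^const>\<open>arcosh\<close>, instantiated to the complex numbers, is a different branch: on
  \<open>x < - 1\<close> it has negative real part. On the reals \<open>x \<ge> 1\<close> the two agree.
\<close>

definition Arccosh :: "complex \<Rightarrow> complex" where
  "Arccosh w = Ln (w + csqrt (w + 1) * csqrt (w - 1))"

lemma Arccosh_arg_inverse:
  "(w + csqrt (w + 1) * csqrt (w - 1)) * (w - csqrt (w + 1) * csqrt (w - 1)) = 1"
proof -
  have "(csqrt (w + 1) * csqrt (w - 1))\<^sup>2 = (w + 1) * (w - 1)"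
    by (simp add: power_mult_distrib)
  then show ?thesis
    by (simp add: algebra_simps power2_eq_square)
qed

lemma cosh_Arccosh: "cosh (Arccosh w) = w"
proof -
  let ?s = "csqrt (w + 1) * csqrt (w - 1)"
  have inv: "(w + ?s) * (w - ?s) = 1"
    by (rule Arccosh_arg_inverse)
  then have nz: "w + ?s \<noteq> 0"
    by auto
  then have "inverse (w + ?s) = w - ?s"
    using inv by (metis inverse_unique)
  moreover have "exp (Arccosh w) = w + ?s"
    using nz by (simp add: Arccosh_def)
  ultimately show ?thesis
    by (simp add: cosh_def exp_minus scaleR_conv_of_real)
qed

lemma Arccosh_of_real:
  assumes "x \<ge> 1"
  shows "Arccosh (complex_of_real x) = complex_of_real (arcosh x)"
proof -
  have "csqrt (complex_of_real x + 1) = complex_of_real (sqrt (x + 1))"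
       "csqrt (complex_of_real x - 1) = complex_of_real (sqrt (x - 1))"
    using assms of_real_sqrt[of "x + 1"] of_real_sqrt[of "x - 1"] by simp_all
  then have "complex_of_real x + csqrt (complex_of_real x + 1) * csqrt (complex_of_real x - 1)
      = complex_of_real (x + sqrt (x\<^sup>2 - 1))"
    by (simp add: real_sqrt_mult[symmetric] algebra_simps power2_eq_square
        flip: of_real_mult)
  moreover have pos: "x + sqrt (x\<^sup>2 - 1) > 0"
    using assms by (smt (verit) real_sqrt_ge_zero one_le_power)
  moreover have "Ln (complex_of_real (x + sqrt (x\<^sup>2 - 1))) = complex_of_real (ln (x + sqrt (x\<^sup>2 - 1)))"
    using pos by (rule Ln_of_real)
  ultimately show ?thesis
    using assms by (simp add: Arccosh_def arcosh_real_def)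
qed

lemma Arccosh_of_real_neg:
  assumes "x \<ge> 1"
  shows "Arccosh (- complex_of_real x) = complex_of_real (arcosh x) + \<i> * complex_of_real pi"
proof -
  have "csqrt (- complex_of_real x + 1) = \<i> * complex_of_real (sqrt (x - 1))"
       "csqrt (- complex_of_real x - 1) = \<i> * complex_of_real (sqrt (x + 1))"
    using assms csqrt_of_real_nonpos[of "1 - x"] csqrt_of_real_nonpos[of "- x - 1"]
    by (simp_all add: add.commute)
  then have "- complex_of_real x + csqrt (- complex_of_real x + 1) * csqrt (- complex_of_real x - 1)
      = - complex_of_real (x + sqrt (x\<^sup>2 - 1))"
    by (simp add: real_sqrt_mult[symmetric] algebra_simps power2_eq_square
        flip: of_real_mult)
  moreover have pos: "x + sqrt (x\<^sup>2 - 1) > 0"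
    using assms by (smt (verit) real_sqrt_ge_zero one_le_power)
  moreover have "Ln (- complex_of_real (x + sqrt (x\<^sup>2 - 1)))
      = Ln (complex_of_real (x + sqrt (x\<^sup>2 - 1))) + \<i> * complex_of_real pi"
    using pos by (subst Ln_minus) (auto simp flip: of_real_add)
  moreover have "Ln (complex_of_real (x + sqrt (x\<^sup>2 - 1))) = complex_of_real (ln (x + sqrt (x\<^sup>2 - 1)))"
    using pos by (rule Ln_of_real)
  ultimately show ?thesis
    using assms by (simp add: Arccosh_def arcosh_real_def)
qed

text \<open>
  Outside the winding region the argument of \<open>arccosh\<close> is a real number of modulus greater than 1
  which can be negative. In that case \<open>arccosh\<close> has imaginary part \<open>pi\<close>, which only changes the
  sign of \<open>exp (- (r \<plusminus> \<beta>))\<close>; the modulus, which is what a quotient of absolute values can equal,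
  is determined by the real part.
\<close>

definition beta_tilde :: "nat \<Rightarrow> (int \<Rightarrow> real) \<Rightarrow> (int \<Rightarrow> real) \<Rightarrow> (int \<Rightarrow> real) \<Rightarrow> real \<Rightarrow> real" where
  "beta_tilde k a b c lam =
     Re (Arccosh (complex_of_real
       (- (g_symbol k a b c lam / (2 * A_coeff k c * exp (decay_r k b c))))))"

section \<open>The defected operator\<close>

definition laurent ::
  "(int \<Rightarrow> real) \<Rightarrow> (int \<Rightarrow> real) \<Rightarrow> (int \<Rightarrow> real) \<Rightarrow> int \<Rightarrow> int \<Rightarrow> real" where
  "laurent a b c i j =
     (if j = i then a i
      else if j = i + 1 then b i
      else if i = j + 1 then c j
      else 0)"

definition square_summable :: "(int \<Rightarrow> complex) \<Rightarrow> bool" where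
  "square_summable u \<longleftrightarrow> (\<lambda>i. (cmod (u i))\<^sup>2) summable_on UNIV"

text \<open>
  The row \<open>m\<close> of the defected operator is an arbitrary sequence \<open>d\<close>. A perturbation of only the
  three entries \<open>(m, m - 1)\<close>, \<open>(m, m)\<close>, \<open>(m, m + 1)\<close> is a special case.
\<close>

definition defected_laurent ::
  "(int \<Rightarrow> real) \<Rightarrow> (int \<Rightarrow> real) \<Rightarrow> (int \<Rightarrow> real) \<Rightarrow> int \<Rightarrow> (int \<Rightarrow> complex) \<Rightarrow> int \<Rightarrow> int \<Rightarrow> complex"
  where
  "defected_laurent a b c m d i j = (if i = m then d j else complex_of_real (laurent a b c i j))"

text \<open>Eigenvectors are nonzero elements of \<open>\<ell>\<^sup>2(\<int>)\<close>; the rows of \<open>L\<close> are meant to be in \<open>\<ell>\<^sup>2(\<int>)\<close>.\<close>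

definition is_eigenvector :: "(int \<Rightarrow> int \<Rightarrow> complex) \<Rightarrow> (int \<Rightarrow> complex) \<Rightarrow> complex \<Rightarrow> bool" where
  "is_eigenvector L u lam \<longleftrightarrow>
     square_summable u \<and> u \<noteq> (\<lambda>_. 0) \<and> (\<forall>i. (\<Sum>\<^sub>\<infinity>j. L i j * u j) = lam * u i)"

end

(*
  Away from the defect, u satisfies a three-term recurrence with k-periodic coefficients, so along
  each residue class modulo k it satisfies B u(i+2k) + g u(i+k) + A u(i) = 0: the monodromy matrix
  has trace -g/B and determinant A/B, where det (f(z) - lambda) = A z + B / z + g. Its eigenvalues
  have moduli exp (-(r - beta)) and exp (-(r + beta)). The curve of the symbol is an ellipse centred
  at g, traversed counterclockwise because |B| > |A|; its real semi-axis is |A + B|. Hence lambda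
  lies outside the winding region iff |g| >= |A + B|, which amounts to beta >= r. The first
  eigenvalue then has modulus at least 1 and the second less than 1, so square summability excludes
  the first to the right of the defect and the second to the left.
*)
theory Submission
  imports Defs
begin

section \<open>Tridiagonal determinants\<close>

text \<open>
  \<open>continuant \<alpha> \<delta> i n\<close> is the determinant of the tridiagonal matrix on the sites
  \<open>i + 1, \<dots>, i + n\<close> with diagonal \<open>\<alpha>\<close>, where \<open>\<delta> j\<close> is the product of the two entries
  coupling \<open>j\<close> and \<open>j + 1\<close>.
\<close>

fun continuant :: "(int \<Rightarrow> 'a::comm_ring_1) \<Rightarrow> (int \<Rightarrow> 'a) \<Rightarrow> int \<Rightarrow> nat \<Rightarrow> 'a" where
  "continuant \<alpha> \<delta> i 0 = 1"
| "continuant \<alpha> \<delta> i (Suc 0) = \<alpha> (i + 1)"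
| "continuant \<alpha> \<delta> i (Suc (Suc n)) =
     \<alpha> (i + int n + 2) * continuant \<alpha> \<delta> i (Suc n) - \<delta> (i + int n + 1) * continuant \<alpha> \<delta> i n"

text \<open>Both sides obey the recursion at the last site, so agreement for two consecutive sizes
  propagates. Expansion at the first site is what Laplace expansion along row 0 and a shift of the
  starting site call for.\<close>

lemma continuant_front:
  "continuant \<alpha> \<delta> i (Suc (Suc n)) =
     \<alpha> (i + 1) * continuant \<alpha> \<delta> (i + 1) (Suc n) - \<delta> (i + 1) * continuant \<alpha> \<delta> (i + 2) n"
proof (induction n rule: induct_nat_012)
  case (ge2 n)
  have "continuant \<alpha> \<delta> i (Suc (Suc (Suc (Suc n)))) =
      \<alpha> (i + int n + 4) * continuant \<alpha> \<delta> i (Suc (Suc (Suc n)))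
      - \<delta> (i + int n + 3) * continuant \<alpha> \<delta> i (Suc (Suc n))"
    by (simp only: continuant.simps) (simp add: algebra_simps)
  also have "\<dots> = \<alpha> (i + 1) * (\<alpha> (i + int n + 4) * continuant \<alpha> \<delta> (i + 1) (Suc (Suc n))
        - \<delta> (i + int n + 3) * continuant \<alpha> \<delta> (i + 1) (Suc n))
      - \<delta> (i + 1) * (\<alpha> (i + int n + 4) * continuant \<alpha> \<delta> (i + 2) (Suc n)
        - \<delta> (i + int n + 3) * continuant \<alpha> \<delta> (i + 2) n)"
    unfolding ge2 by (simp add: algebra_simps)
  also have "\<dots> = \<alpha> (i + 1) * continuant \<alpha> \<delta> (i + 1) (Suc (Suc (Suc n)))
      - \<delta> (i + 1) * continuant \<alpha> \<delta> (i + 2) (Suc (Suc n))"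
    by (simp add: algebra_simps)
  finally show ?case .
qed (simp_all add: algebra_simps)

text \<open>Passing from \<open>n\<close> to \<open>n + 1\<close> multiplies the left side by
  \<open>\<delta> (i + int n + 2)\<close>, since the \<open>\<alpha>\<close> terms cancel. The
  identity later gives the determinant of the monodromy matrix.\<close>

lemma continuant_cassini:
  "continuant \<alpha> \<delta> i (Suc n) * continuant \<alpha> \<delta> (i + 1) (Suc n)
     - continuant \<alpha> \<delta> i (Suc (Suc n)) * continuant \<alpha> \<delta> (i + 1) n
   = (\<Prod>j = 1..Suc n. \<delta> (i + int j))"
proof (induction n)
  case (Suc n)
  let ?K = "continuant \<alpha> \<delta>"
  have "?K i (Suc (Suc n)) * ?K (i + 1) (Suc (Suc n)) - ?K i (Suc (Suc (Suc n))) * ?K (i + 1) (Suc n)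
      = \<delta> (i + int n + 2) *
        (?K i (Suc n) * ?K (i + 1) (Suc n) - ?K i (Suc (Suc n)) * ?K (i + 1) n)"
    unfolding continuant.simps(3)[of \<alpha> \<delta> i "Suc n"] continuant.simps(3)[of \<alpha> \<delta> "i + 1" n]
    by (simp add: algebra_simps del: continuant.simps)
  then show ?case
    unfolding Suc by (simp add: mult.commute algebra_simps del: continuant.simps)
qed (simp add: algebra_simps)

lemma of_real_continuant:
  "of_real (continuant \<alpha> \<delta> i n) = continuant (\<lambda>j. of_real (\<alpha> j)) (\<lambda>j. of_real (\<delta> j)) i n"
  by (induction n rule: induct_nat_012) simp_all

lemma continuant_periodic:
  assumes "\<And>j. \<alpha> (j + p) = \<alpha> j" and "\<And>j. \<delta> (j + p) = \<delta> j"
  shows "continuant \<alpha> \<delta> (i + p) n = continuant \<alpha> \<delta> i n"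
proof (induction n rule: induct_nat_012)
  case 1
  then show ?case using assms(1)[of "i + 1"] by (simp add: algebra_simps)
next
  case (ge2 n)
  then show ?case using assms(1)[of "i + int n + 2"] assms(2)[of "i + int n + 1"]
    by (simp add: algebra_simps)
qed simp

section \<open>Determinants of tridiagonal matrices, without and with corner entries\<close>

definition tridiag ::
  "(int \<Rightarrow> 'a::comm_ring_1) \<Rightarrow> (int \<Rightarrow> 'a) \<Rightarrow> (int \<Rightarrow> 'a) \<Rightarrow> int \<Rightarrow> nat \<Rightarrow> 'a mat" where
  "tridiag \<alpha> \<beta> \<gamma> i n = mat n n (\<lambda>(r, s).
     if r = s then \<alpha> (i + int r + 1)
     else if s = r + 1 then \<beta> (i + int r + 1)
     else if r = s + 1 then \<gamma> (i + int s + 1) else 0)"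

lemma tridiag_carrier [simp]: "tridiag \<alpha> \<beta> \<gamma> i n \<in> carrier_mat n n"
  by (simp add: tridiag_def)

lemma mat_delete_mat:
  "mat_delete (mat (Suc m) (Suc n) f) i j =
     mat m n (\<lambda>(r, s). f (if r < i then r else Suc r, if s < j then s else Suc s))"
  by (rule eq_matI) (auto simp: mat_delete_def)

text \<open>Laplace expansion with the sum cut down to a set \<open>J\<close> containing the support
  of row 0. The minors are again \<open>mat\<close> of a function, so that expansions can be
  iterated.\<close>

lemma det_row_0:
  fixes f :: "nat \<times> nat \<Rightarrow> 'a::comm_ring_1"
  assumes "J \<subseteq> {..n}" and "\<And>j. j \<le> n \<Longrightarrow> j \<notin> J \<Longrightarrow> f (0, j) = 0"
  shows "det (mat (Suc n) (Suc n) f) =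
    (\<Sum>j\<in>J. f (0, j) * (-1) ^ j * det (mat n n (\<lambda>(r, s). f (Suc r, if s < j then s else Suc s))))"
proof -
  have "det (mat (Suc n) (Suc n) f) =
      (\<Sum>j\<in>{..n}. f (0, j) * (-1) ^ j * det (mat n n (\<lambda>(r, s). f (Suc r, if s < j then s else Suc s))))"
    by (subst laplace_expansion_row[of _ "Suc n" 0])
      (auto simp: cofactor_def mat_delete_mat lessThan_Suc_atMost intro!: sum.cong)
  also have "\<dots> =
      (\<Sum>j\<in>J. f (0, j) * (-1) ^ j * det (mat n n (\<lambda>(r, s). f (Suc r, if s < j then s else Suc s))))"
    using assms by (intro sum.mono_neutral_right) auto
  finally show ?thesis .
qed

lemma det_col_0:
  fixes f :: "nat \<times> nat \<Rightarrow> 'a::comm_ring_1"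
  assumes "I \<subseteq> {..n}" and "\<And>i. i \<le> n \<Longrightarrow> i \<notin> I \<Longrightarrow> f (i, 0) = 0"
  shows "det (mat (Suc n) (Suc n) f) =
    (\<Sum>i\<in>I. f (i, 0) * (-1) ^ i * det (mat n n (\<lambda>(r, s). f (if r < i then r else Suc r, Suc s))))"
proof -
  have "det (mat (Suc n) (Suc n) f) =
      (\<Sum>i\<in>{..n}. f (i, 0) * (-1) ^ i * det (mat n n (\<lambda>(r, s). f (if r < i then r else Suc r, Suc s))))"
    by (subst laplace_expansion_column[of _ "Suc n" 0])
      (auto simp: cofactor_def mat_delete_mat lessThan_Suc_atMost intro!: sum.cong)
  also have "\<dots> =
      (\<Sum>i\<in>I. f (i, 0) * (-1) ^ i * det (mat n n (\<lambda>(r, s). f (if r < i then r else Suc r, Suc s))))"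
    using assms by (intro sum.mono_neutral_right) auto
  finally show ?thesis .
qed

lemma det_mat_cong:
  assumes "\<And>r s. r < n \<Longrightarrow> s < n \<Longrightarrow> f (r, s) = g (r, s)"
  shows "det (mat n n f) = det (mat n n g)"
proof -
  have "mat n n f = mat n n g" using assms by (intro eq_matI) auto
  then show ?thesis by simp
qed

lemma det_mat_lower_triangular:
  assumes "\<And>r s. r < s \<Longrightarrow> s < n \<Longrightarrow> f (r, s) = 0"
  shows "det (mat n n f) = (\<Prod>r<n. f (r, r))"
  using assms
  by (subst det_lower_triangular[where n = n]) (auto simp: prod_list_diag_prod atLeast0LessThan)

lemma det_mat_upper_triangular:
  assumes "\<And>r s. s < r \<Longrightarrow> r < n \<Longrightarrow> f (r, s) = 0"
  shows "det (mat n n f) = (\<Prod>r<n. f (r, r))"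
  using assms
  by (subst det_upper_triangular[where n = n])
    (auto simp: prod_list_diag_prod atLeast0LessThan intro!: upper_triangularI)

text \<open>Expansion along row 0 leaves two minors. The one belonging to the superdiagonal entry
  has \<open>\<gamma> (i + 1)\<close> as the only nonzero entry of its column 0, so a second
  expansion reaches the recursion of \<open>continuant_front\<close>.\<close>

lemma det_tridiag:
  "det (tridiag \<alpha> \<beta> \<gamma> i n) = continuant \<alpha> (\<lambda>j. \<beta> j * \<gamma> j) i n"
proof (induction n arbitrary: i rule: induct_nat_012)
  case 0
  show ?case by simp
next
  case 1
  show ?case by (subst det_single) (auto simp: tridiag_def)
next
  case (ge2 n)
  define f where "f = (\<lambda>(r, s).
     if r = s then \<alpha> (i + int r + 1)
     else if s = r + 1 then \<beta> (i + int r + 1)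
     else if r = s + 1 then \<gamma> (i + int s + 1) else 0)"
  have f_row: "f (0, 0) = \<alpha> (i + 1)" "f (0, Suc 0) = \<beta> (i + 1)"
    and f_col: "f (Suc 0, 0) = \<gamma> (i + 1)"
    and f_0: "\<And>j. j > 1 \<Longrightarrow> f (0, j) = 0" "\<And>j. j > 1 \<Longrightarrow> f (j, 0) = 0"
    by (simp_all add: f_def)
  let ?M = "\<lambda>j. det (mat (Suc n) (Suc n) (\<lambda>(r, s). f (Suc r, if s < j then s else Suc s)))"
  have 1: "?M 0 = det (tridiag \<alpha> \<beta> \<gamma> (i + 1) (Suc n))"
    unfolding tridiag_def by (rule det_mat_cong) (auto simp: f_def algebra_simps)
  have 2: "?M 1 = \<gamma> (i + 1) * det (tridiag \<alpha> \<beta> \<gamma> (i + 2) n)"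
  proof -
    have "?M 1 = \<gamma> (i + 1) * det (mat n n (\<lambda>(r, s). f (Suc (Suc r), Suc (Suc s))))"
      by (subst det_col_0[where I = "{0}"]) (auto simp: f_col f_0)
    also have "det (mat n n (\<lambda>(r, s). f (Suc (Suc r), Suc (Suc s)))) = det (tridiag \<alpha> \<beta> \<gamma> (i + 2) n)"
      unfolding tridiag_def by (rule det_mat_cong) (auto simp: f_def algebra_simps)
    finally show ?thesis .
  qed
  have "det (tridiag \<alpha> \<beta> \<gamma> i (Suc (Suc n))) = det (mat (Suc (Suc n)) (Suc (Suc n)) f)"
    unfolding tridiag_def by (rule det_mat_cong) (auto simp: f_def)
  also have "\<dots> = \<alpha> (i + 1) * ?M 0 - \<beta> (i + 1) * ?M 1"
    by (subst det_row_0[where J = "{0, 1}"]) (auto simp: f_row f_0)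
  finally have "det (tridiag \<alpha> \<beta> \<gamma> i (Suc (Suc n))) = \<alpha> (i + 1) * ?M 0 - \<beta> (i + 1) * ?M 1" .
  then show ?case
    unfolding 1 2 ge2 continuant_front by (simp add: algebra_simps)
qed

text \<open>In terms of permutations: using both corners leaves the inner tridiagonal block, while
  using just one forces an \<open>N\<close>-cycle through all subdiagonal or all superdiagonal
  entries, of sign \<open>(-1) ^ (N - 1) = (-1) ^ n\<close>. Size at least 3 keeps the corners off
  the band.\<close>

lemma det_tridiag_corners:
  fixes n :: nat
  defines "N \<equiv> Suc (Suc (Suc n))"
  shows "det (mat N N (\<lambda>(r, s). tridiag \<alpha> \<beta> \<gamma> i N $$ (r, s)
      + (if r = 0 \<and> s = N - 1 then x else 0) + (if r = N - 1 \<and> s = 0 then y else 0)))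
    = det (tridiag \<alpha> \<beta> \<gamma> i N) - x * y * det (tridiag \<alpha> \<beta> \<gamma> (i + 1) (Suc n))
      + (-1) ^ n * (x * (\<Prod>j = 1..Suc (Suc n). \<gamma> (i + int j)) + y * (\<Prod>j = 1..Suc (Suc n). \<beta> (i + int j)))"
proof -
  define f where "f = (\<lambda>(r, s).
     if r = s then \<alpha> (i + int r + 1)
     else if s = r + 1 then \<beta> (i + int r + 1)
     else if r = s + 1 then \<gamma> (i + int s + 1)
     else if r = 0 \<and> s = Suc (Suc n) then x
     else if r = Suc (Suc n) \<and> s = 0 then y else 0)"
  have f_row: "f (0, 0) = \<alpha> (i + 1)" "f (0, Suc 0) = \<beta> (i + 1)"
    and f_col: "f (Suc 0, 0) = \<gamma> (i + 1)"
    and f_corner: "f (0, Suc (Suc n)) = x" "f (Suc (Suc n), 0) = y"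
    and f_0: "\<And>j. j > 1 \<Longrightarrow> j < Suc (Suc n) \<Longrightarrow> f (0, j) = 0"
      "\<And>j. j > 1 \<Longrightarrow> j < Suc (Suc n) \<Longrightarrow> f (j, 0) = 0"
    by (simp_all add: f_def)
  let ?M = "\<lambda>j. det (mat (Suc (Suc n)) (Suc (Suc n)) (\<lambda>(r, s). f (Suc r, if s < j then s else Suc s)))"
  have "det (mat N N (\<lambda>(r, s). tridiag \<alpha> \<beta> \<gamma> i N $$ (r, s)
      + (if r = 0 \<and> s = N - 1 then x else 0) + (if r = N - 1 \<and> s = 0 then y else 0))) = det (mat N N f)"
    by (rule det_mat_cong) (auto simp: tridiag_def f_def N_def)
  also have "\<dots> = \<alpha> (i + 1) * ?M 0 - \<beta> (i + 1) * ?M 1 + x * (-1) ^ n * ?M (Suc (Suc n))"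
    unfolding N_def by (subst det_row_0[where J = "{0, 1, Suc (Suc n)}"]) (auto simp: f_row f_corner f_0)
  also have "?M 0 = det (tridiag \<alpha> \<beta> \<gamma> (i + 1) (Suc (Suc n)))"
    unfolding tridiag_def by (rule det_mat_cong) (auto simp: f_def algebra_simps)
  \<comment> \<open>Column 0 of this minor holds \<open>\<gamma> (i + 1)\<close> at the top and
    \<open>y\<close> at the bottom. Striking out the row of \<open>y\<close> leaves a lower
    triangular matrix with the \<open>\<beta>\<close> on its diagonal.\<close>
  also have "?M 1 = \<gamma> (i + 1) * det (tridiag \<alpha> \<beta> \<gamma> (i + 2) (Suc n))
      - y * (-1) ^ n * (\<Prod>r<Suc n. \<beta> (i + int r + 2))"
  proof -
    have "?M 1 = \<gamma> (i + 1) * det (mat (Suc n) (Suc n) (\<lambda>(r, s). f (Suc (Suc r), Suc (Suc s))))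
        - y * (-1) ^ n * det (mat (Suc n) (Suc n) (\<lambda>(r, s). f (Suc (if r < Suc n then r else Suc r), Suc (Suc s))))"
      by (subst det_col_0[where I = "{0, Suc n}"]) (auto simp: f_col f_corner f_0)
    also have "det (mat (Suc n) (Suc n) (\<lambda>(r, s). f (Suc (Suc r), Suc (Suc s)))) = det (tridiag \<alpha> \<beta> \<gamma> (i + 2) (Suc n))"
      unfolding tridiag_def by (rule det_mat_cong) (auto simp: f_def algebra_simps)
    also have "det (mat (Suc n) (Suc n) (\<lambda>(r, s). f (Suc (if r < Suc n then r else Suc r), Suc (Suc s))))
        = (\<Prod>r<Suc n. \<beta> (i + int r + 2))"
      by (subst det_mat_lower_triangular) (auto simp: f_def algebra_simps intro!: prod.cong)
    finally show ?thesis .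
  qed
  \<comment> \<open>Here the last column is gone: striking out the row of
    \<open>\<gamma> (i + 1)\<close> leaves an upper triangular matrix with the
    \<open>\<gamma>\<close> on its diagonal, and striking out the row of \<open>y\<close> a
    tridiagonal block.\<close>
  also have "?M (Suc (Suc n)) = \<gamma> (i + 1) * (\<Prod>r<Suc n. \<gamma> (i + int r + 2))
      - y * (-1) ^ n * det (tridiag \<alpha> \<beta> \<gamma> (i + 1) (Suc n))"
  proof -
    have "?M (Suc (Suc n)) = \<gamma> (i + 1) * det (mat (Suc n) (Suc n) (\<lambda>(r, s). f (Suc (Suc r), Suc s)))
        - y * (-1) ^ n * det (mat (Suc n) (Suc n) (\<lambda>(r, s). f (Suc r, Suc s)))"
      by (subst det_col_0[where I = "{0, Suc n}"]) 
       (auto simp: f_col f_corner f_0 intro!: arg_cong2[where f = "(*)"] arg_cong2[where f = "(-)"] det_mat_cong)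
    also have "det (mat (Suc n) (Suc n) (\<lambda>(r, s). f (Suc r, Suc s))) = det (tridiag \<alpha> \<beta> \<gamma> (i + 1) (Suc n))"
      unfolding tridiag_def by (rule det_mat_cong) (auto simp: f_def algebra_simps)
    also have "det (mat (Suc n) (Suc n) (\<lambda>(r, s). f (Suc (Suc r), Suc s)))
        = (\<Prod>r<Suc n. \<gamma> (i + int r + 2))"
      by (subst det_mat_upper_triangular) (auto simp: f_def algebra_simps intro!: prod.cong)
    finally show ?thesis .
  qed
  finally have main: "det (mat N N (\<lambda>(r, s). tridiag \<alpha> \<beta> \<gamma> i N $$ (r, s)
      + (if r = 0 \<and> s = N - 1 then x else 0) + (if r = N - 1 \<and> s = 0 then y else 0))) =
    \<alpha> (i + 1) * det (tridiag \<alpha> \<beta> \<gamma> (i + 1) (Suc (Suc n)))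
    - \<beta> (i + 1) * (\<gamma> (i + 1) * det (tridiag \<alpha> \<beta> \<gamma> (i + 2) (Suc n))
        - y * (-1) ^ n * (\<Prod>r<Suc n. \<beta> (i + int r + 2)))
    + x * (-1) ^ n * (\<gamma> (i + 1) * (\<Prod>r<Suc n. \<gamma> (i + int r + 2))
        - y * (-1) ^ n * det (tridiag \<alpha> \<beta> \<gamma> (i + 1) (Suc n)))" .
  have prod: "(\<Prod>j = 1..Suc (Suc n). h (i + int j)) = h (i + 1) * (\<Prod>r<Suc n. h (i + int r + 2))"
    for h :: "int \<Rightarrow> 'a"
    by (induction n) (simp_all add: algebra_simps)
  have sq: "(-1) ^ n * (-1) ^ n = (1::'a)"
    by (simp flip: power_add)
  have sq': "x * (-1) ^ n * (y * (-1) ^ n * D) = x * y * D" for D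
    using sq by (metis mult.assoc mult.left_commute mult_1)
  show ?thesis
    unfolding main
    unfolding N_def det_tridiag continuant_front[of _ _ _ "Suc n"] prod
    using sq'[of "continuant \<alpha> (\<lambda>j. \<beta> j * \<gamma> j) (i + 1) (Suc n)"]
    by (simp add: algebra_simps del: continuant.simps prod.lessThan_Suc)
qed

section \<open>The determinant of the symbol as a Laurent polynomial\<close>

lemma tridiag_A_zero:
  "A_zero k a b c - lam \<cdot>\<^sub>m 1\<^sub>m k = tridiag (\<lambda>j. a j - lam) b c 0 k"
  by (rule eq_matI) (auto simp: A_zero_def tridiag_def algebra_simps)

lemma g_symbol_1: "g_symbol (Suc 0) a b c lam = a 1 - lam"
  by (simp add: g_symbol_def p_minor_def tridiag_A_zero det_tridiag)

text \<open>At \<open>n = 0\<close> the inner continuant is 1, which is the convention for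
  \<open>p_minor\<close> at size 2, so one formula serves all sizes from 2 on.\<close>

lemma g_symbol_Suc_Suc:
  "g_symbol (Suc (Suc n)) a b c lam =
    continuant (\<lambda>j. a j - lam) (\<lambda>j. b j * c j) 0 (Suc (Suc n))
    - b (int n + 2) * c (int n + 2) * continuant (\<lambda>j. a j - lam) (\<lambda>j. b j * c j) 1 n"
proof -
  have "det (mat n n (\<lambda>(i, j). tridiag (\<lambda>j. a j - lam) b c 0 (Suc (Suc n)) $$ (i + 1, j + 1)))
      = det (tridiag (\<lambda>j. a j - lam) b c 1 n)"
    unfolding tridiag_def by (rule det_mat_cong) (auto simp: algebra_simps)
  then have "p_minor (Suc (Suc n)) a b c lam = continuant (\<lambda>j. a j - lam) (\<lambda>j. b j * c j) 1 n"
    unfolding p_minor_def tridiag_A_zero by (cases n) (simp_all add: det_tridiag del: continuant.simps(3))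
  then show ?thesis
    by (simp add: g_symbol_def tridiag_A_zero det_tridiag algebra_simps del: continuant.simps(3))
qed

lemma det_mat_2:
  "det (mat 2 2 f) = f (0, 0) * f (1, 1) - f (0, 1) * f (1, 0)" for f :: "nat \<times> nat \<Rightarrow> 'a::comm_ring_1"
  unfolding numeral_2_eq_2
  by (subst det_row_0[where J = "{0, 1}"]) (auto simp: det_single)

text \<open>The symbol adds corners to a tridiagonal matrix. They lie off the band only for
  \<open>k \<ge> 3\<close>; for \<open>k = 1\<close> they fall on the diagonal and for
  \<open>k = 2\<close> on the off-diagonals, hence the three cases.\<close>

lemma det_symbol:
  assumes "k \<ge> 1" and z: "z \<noteq> 0"
  shows "det (symbol k a b c z - complex_of_real lam \<cdot>\<^sub>m 1\<^sub>m k)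
    = complex_of_real (A_coeff k c) * z
      + complex_of_real ((- 1) ^ (k + 1) * (\<Prod>i = 1..k. b (int i))) * inverse z
      + complex_of_real (g_symbol k a b c lam)"
proof -
  let ?\<alpha> = "\<lambda>j. complex_of_real (a j - lam)" and ?\<beta> = "\<lambda>j. complex_of_real (b j)"
    and ?\<gamma> = "\<lambda>j. complex_of_real (c j)"
  define x y where "x = z * complex_of_real (c (int k))" and "y = inverse z * complex_of_real (b (int k))"
  \<comment> \<open>The powers of \<open>z\<close> cancel in the product of the corners, so for
    \<open>k \<ge> 2\<close> the pair contributes to the constant term only, as the
    \<open>p_minor\<close> summand of \<open>g_symbol\<close>.\<close>
  have xy: "x * y = complex_of_real (b (int k) * c (int k))"
    using z by (simp add: x_def y_def)
  let ?f = "\<lambda>(r, s). tridiag ?\<alpha> ?\<beta> ?\<gamma> 0 k $$ (r, s)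
      + (if r = 0 \<and> s = k - 1 then x else 0) + (if r = k - 1 \<and> s = 0 then y else 0)"
  have M: "symbol k a b c z - complex_of_real lam \<cdot>\<^sub>m 1\<^sub>m k = mat k k ?f"
    by (rule eq_matI)
      (auto simp: symbol_def A_minus_def A_plus_def A_zero_def tridiag_def x_def y_def algebra_simps)
  consider "k = Suc 0" | "k = 2" | n where "k = Suc (Suc (Suc n))"
    using \<open>k \<ge> 1\<close> by (metis One_nat_def Suc_1 Suc_n_not_le_n old.nat.exhaust le0)
  then show ?thesis
  proof cases
    case 1
    have "det (mat k k ?f) = ?f (0, 0)"
      using 1 by (subst det_single) auto
    then show ?thesis
      using 1 unfolding M
      by (simp add: tridiag_def x_def y_def A_coeff_def g_symbol_1 algebra_simps)
  next
    case 2
    have "det (mat k k ?f) = ?f (0, 0) * ?f (1, 1) - ?f (0, 1) * ?f (1, 0)"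
      using 2 by (simp only: det_mat_2)
    also have "\<dots> = ?\<alpha> 1 * ?\<alpha> 2 - (?\<beta> 1 + x) * (?\<gamma> 1 + y)"
      using 2 by (simp add: tridiag_def)
    also have "\<dots> = ?\<alpha> 1 * ?\<alpha> 2 - ?\<beta> 1 * ?\<gamma> 1 - ?\<gamma> 1 * x - ?\<beta> 1 * y - x * y"
      by (simp add: algebra_simps)
    finally have D: "det (mat k k ?f) = ?\<alpha> 1 * ?\<alpha> 2 - ?\<beta> 1 * ?\<gamma> 1 - ?\<gamma> 1 * x - ?\<beta> 1 * y - x * y" .
    have g: "g_symbol k a b c lam = (a 1 - lam) * (a 2 - lam) - b 1 * c 1 - b 2 * c 2"
      using 2 g_symbol_Suc_Suc[of 0 a b c lam] by (simp add: numeral_2_eq_2 algebra_simps)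
    have P: "(\<Prod>i = 1..k. h (int i)) = h 1 * h 2" for h :: "int \<Rightarrow> real"
      using 2 by (simp add: numeral_2_eq_2)
    show ?thesis
      unfolding M D xy A_coeff_def g P using 2 by (simp add: x_def y_def algebra_simps)
  next
    case 3
    let ?K = "continuant (\<lambda>j. a j - lam) (\<lambda>j. b j * c j)"
    have D: "det (mat k k ?f) = det (tridiag ?\<alpha> ?\<beta> ?\<gamma> 0 k) - x * y * det (tridiag ?\<alpha> ?\<beta> ?\<gamma> 1 (Suc n))
      + (-1) ^ n * (x * (\<Prod>j = 1..Suc (Suc n). ?\<gamma> (int j)) + y * (\<Prod>j = 1..Suc (Suc n). ?\<beta> (int j)))"
      using det_tridiag_corners[where \<alpha> = ?\<alpha> and \<beta> = ?\<beta> and \<gamma> = ?\<gamma> and i = 0 and n = n and x = x and y = y] unfolding 3 by simp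
    have K: "det (tridiag ?\<alpha> ?\<beta> ?\<gamma> i l) = complex_of_real (?K i l)" for i l
      by (simp add: det_tridiag of_real_continuant)
    have g: "g_symbol k a b c lam = ?K 0 k - b (int k) * c (int k) * ?K 1 (Suc n)"
      using g_symbol_Suc_Suc[of "Suc n" a b c lam] unfolding 3
      by (simp add: algebra_simps del: continuant.simps)
    have P: "(\<Prod>i = 1..k. h (int i)) = h (int k) * (\<Prod>j = 1..Suc (Suc n). h (int j))" 
      for h :: "int \<Rightarrow> real"
      unfolding 3 by (simp add: mult.commute)
    have sgn: "(-1) ^ (k + 1) = ((-1) ^ n :: real)" unfolding 3 by simp
    show ?thesis
      unfolding M D xy K A_coeff_def g P sgn
      by (simp add: x_def y_def algebra_simps del: continuant.simps prod.cl_ivl_Suc)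
  qed
qed

section \<open>The winding region\<close>

text \<open>For \<open>B < 0\<close> the curve is a negated circle path of radius
  \<open>- B\<close>, and negation preserves the winding number around 0.\<close>

lemma winding_number_scaled_circle:
  assumes "B \<noteq> 0"
  shows "winding_number (\<lambda>t. complex_of_real B * exp (\<i> * complex_of_real (2 * pi * t))) 0 = 1"
proof (cases "B > 0")
  case True
  have "(\<lambda>t. complex_of_real B * exp (\<i> * complex_of_real (2 * pi * t))) = circlepath 0 B"
    by (auto simp: circlepath fun_eq_iff algebra_simps)
  then show ?thesis
    using True by (simp add: winding_number_circlepath_centre)
next
  case False
  then have "- B > 0" using assms by simp
  have "(\<lambda>t. complex_of_real B * exp (\<i> * complex_of_real (2 * pi * t))) = uminus \<circ> circlepath 0 (- B)"
    by (auto simp: circlepath fun_eq_iff algebra_simps)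
  then show ?thesis
    using \<open>- B > 0\<close> winding_number_negatepath[of "circlepath 0 (- B)"]
    by (simp add: winding_number_circlepath_centre)
qed

text \<open>The ellipse is deformed along straight segments to the circle of its dominant term
  \<open>B\<close>. The claim \<open>nz\<close> says that no point of these segments is 0; its case
  \<open>s = 1\<close> is the ellipse itself.\<close>

lemma winding_number_ellipse:
  fixes A B g :: real
  defines "\<gamma> \<equiv> \<lambda>t. complex_of_real A * exp (- \<i> * complex_of_real (2 * pi * t))
      + complex_of_real B * exp (\<i> * complex_of_real (2 * pi * t)) + complex_of_real g"
  assumes AB: "A * B > 0" "\<bar>A\<bar> < \<bar>B\<bar>" and g: "\<bar>g\<bar> < \<bar>A + B\<bar>"
  shows "0 \<notin> path_image \<gamma>" and "winding_number \<gamma> 0 = 1"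
proof -
  let ?h = "\<lambda>t. complex_of_real B * exp (\<i> * complex_of_real (2 * pi * t))"
  have nz: "complex_of_real s * (complex_of_real A * exp (- \<i> * complex_of_real \<theta>) + complex_of_real g)
      + complex_of_real B * exp (\<i> * complex_of_real \<theta>) \<noteq> 0" 
    if s: "0 \<le> s" "s \<le> 1" for s \<theta> :: real
  proof
    assume eq: "complex_of_real s * (complex_of_real A * exp (- \<i> * complex_of_real \<theta>) + complex_of_real g)
      + complex_of_real B * exp (\<i> * complex_of_real \<theta>) = 0"
    \<comment> \<open>The imaginary part factors as \<open>(B - s * A) * sin \<theta>\<close>, which
      forces \<open>sin \<theta> = 0\<close>; the real part then reads
      \<open>\<bar>s * A + B\<bar> = s * \<bar>g\<bar>\<close>.\<close>
    have re: "s * (A * cos \<theta> + g) + B * cos \<theta> = 0" and im: "- s * A * sin \<theta> + B * sin \<theta> = 0"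
      using arg_cong[OF eq, of Re] arg_cong[OF eq, of Im] by (simp_all add: Re_exp Im_exp)
    have "\<bar>s * A\<bar> < \<bar>B\<bar>"
      using s AB(2) mult_left_le_one_le[of "\<bar>A\<bar>" s] by (simp add: abs_mult)
    then have "B - s * A \<noteq> 0" by auto
    moreover have "(B - s * A) * sin \<theta> = 0" using im by (simp add: algebra_simps)
    ultimately have "sin \<theta> = 0" by simp
    then have "\<bar>cos \<theta>\<bar> = 1" 
      by (rule sin_zero_abs_cos_one)
    moreover have "\<bar>(s * A + B) * cos \<theta>\<bar> = \<bar>s * g\<bar>"
    proof -
      have "(s * A + B) * cos \<theta> = - (s * g)" using re by (simp add: algebra_simps)
      then show ?thesis by simp
    qed
    ultimately have "\<bar>s * A + B\<bar> = s * \<bar>g\<bar>"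
      using s by (simp add: abs_mult)
    \<comment> \<open>Equal signs give
      \<open>\<bar>s * A + B\<bar> = s * \<bar>A\<bar> + \<bar>B\<bar>\<close>, which is at least
      \<open>s * \<bar>A + B\<bar>\<close> because \<open>s \<le> 1\<close>. Scaling by
      \<open>s = 0\<close> loses the strict inequality for \<open>g\<close>, so positivity is
      recorded separately there.\<close>
    moreover have "\<bar>s * A + B\<bar> \<ge> s * \<bar>A + B\<bar> \<and> \<bar>B\<bar> > 0 \<and> (s = 0 \<longrightarrow> \<bar>s * A + B\<bar> > 0)"
    proof (cases "A > 0")
      case True
      then have "B > 0" using AB(1) by (simp add: zero_less_mult_iff)
      then have "s * B \<le> B" using s by (simp add: mult_left_le_one_le)
      moreover have "s * A \<ge> 0" using s True by simp
      ultimately show ?thesis using True \<open>B > 0\<close> by (auto simp: distrib_left)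
    next
      case False
      then have "A < 0" "B < 0" using AB(1) by (auto simp: zero_less_mult_iff)
      then have "s * (- B) \<le> - B" using s by (intro mult_left_le_one_le) auto
      moreover have "s * A \<le> 0" using s \<open>A < 0\<close> by (simp add: mult_nonneg_nonpos)
      ultimately show ?thesis using \<open>A < 0\<close> \<open>B < 0\<close> by (auto simp: algebra_simps abs_if)
    qed
    ultimately show False
      using g s mult_strict_left_mono[of "\<bar>g\<bar>" "\<bar>A + B\<bar>" s] by (cases "s = 0") auto
  qed
  have "\<gamma> t \<noteq> 0" for t
    using nz[of 1 "2 * pi * t"] by (simp add: \<gamma>_def algebra_simps)
  then show "0 \<notin> path_image \<gamma>"
    unfolding path_image_def by (metis imageE)
  have "winding_number \<gamma> 0 = winding_number ?h 0"
  proof (rule winding_number_loops_linear_eq)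
    show "path ?h" "path \<gamma>"
      unfolding path_def \<gamma>_def by (intro continuous_intros)+
    show "pathfinish ?h = pathstart ?h" "pathfinish \<gamma> = pathstart \<gamma>"
      using exp_two_pi_i'
      by (simp_all add: pathfinish_def pathstart_def \<gamma>_def exp_minus mult.commute)
    show "0 \<notin> closed_segment (?h t) (\<gamma> t)" for t
    proof
      assume "0 \<in> closed_segment (?h t) (\<gamma> t)"
      then obtain s where "0 \<le> s" "s \<le> 1" "(1 - s) *\<^sub>R ?h t + s *\<^sub>R \<gamma> t = 0"
        unfolding closed_segment_def by force
      then show False
        using nz[of s "2 * pi * t"] by (simp add: \<gamma>_def scaleR_conv_of_real algebra_simps)
    qed
  qed
  then show "winding_number \<gamma> 0 = 1"
    using winding_number_scaled_circle[of B] AB by fastforce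
qed

text \<open>By contraposition: a smaller \<open>g\<close> would place 0 inside the ellipse. The
  symbol is evaluated at exp(-i theta), so it is \<open>B\<close>, the larger coefficient, that
  turns counterclockwise.\<close>

lemma g_symbol_ge_outside_winding:
  assumes "k \<ge> 1" "lam \<notin> sigma_wind k a b c"
    and B: "B = (- 1) ^ (k + 1) * (\<Prod>i = 1..k. b (int i))"
    and AB: "A_coeff k c * B > 0" "\<bar>A_coeff k c\<bar> < \<bar>B\<bar>"
  shows "\<bar>A_coeff k c + B\<bar> \<le> \<bar>g_symbol k a b c lam\<bar>"
proof (rule ccontr)
  assume "\<not> \<bar>A_coeff k c + B\<bar> \<le> \<bar>g_symbol k a b c lam\<bar>"
  then have g: "\<bar>g_symbol k a b c lam\<bar> < \<bar>A_coeff k c + B\<bar>" by simp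
  have "symbol_curve k a b c lam =
      (\<lambda>t. complex_of_real (A_coeff k c) * exp (- \<i> * complex_of_real (2 * pi * t))
        + complex_of_real B * exp (\<i> * complex_of_real (2 * pi * t))
        + complex_of_real (g_symbol k a b c lam))"
    unfolding symbol_curve_def B
    using det_symbol[OF \<open>k \<ge> 1\<close>] by (simp add: fun_eq_iff exp_minus)
  then show False
    using winding_number_ellipse[OF AB g] \<open>lam \<notin> sigma_wind k a b c\<close> by (simp add: sigma_wind_def)
qed

section \<open>The relation over two periods\<close>

text \<open>Eliminating the inner unknowns from rows \<open>i + 1\<close> to
  \<open>i + n + 1\<close> leaves \<open>u (i + n + 2)\<close> in terms of \<open>u i\<close> and
  \<open>u (i + 1)\<close>. The continuants are, up to factors, entries of the transfer matrix;
  keeping the \<open>\<beta>\<close> as factors on the right avoids division.\<close>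

lemma three_term_transfer:
  fixes u \<alpha> \<beta> \<gamma> :: "int \<Rightarrow> 'a::comm_ring_1"
  assumes "\<And>j. i < j \<Longrightarrow> j \<le> i + int n + 1 \<Longrightarrow> \<gamma> (j - 1) * u (j - 1) + \<alpha> j * u j + \<beta> j * u (j + 1) = 0"
  shows "continuant \<alpha> (\<lambda>j. \<beta> j * \<gamma> j) i (Suc n) * u (i + 1)
      + \<gamma> i * continuant \<alpha> (\<lambda>j. \<beta> j * \<gamma> j) (i + 1) n * u i
    = (-1) ^ Suc n * (\<Prod>j = 1..Suc n. \<beta> (i + int j)) * u (i + int n + 2)"
  using assms
proof (induction n rule: induct_nat_012)
  case 0
  show ?case using 0[of "i + 1"] by (simp add: algebra_simps eq_neg_iff_add_eq_0)
next
  case 1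
  have 1: "\<beta> (i + 1) * u (i + 2) = - (\<gamma> i * u i + \<alpha> (i + 1) * u (i + 1))"
    and 2: "\<beta> (i + 2) * u (i + 3) = - (\<gamma> (i + 1) * u (i + 1) + \<alpha> (i + 2) * u (i + 2))"
    using 1[of "i + 1"] 1[of "i + 2"] by (simp_all add: algebra_simps add_eq_0_iff)
  have "\<beta> (i + 1) * \<beta> (i + 2) * u (i + 3) =
      - \<beta> (i + 1) * \<gamma> (i + 1) * u (i + 1) - \<alpha> (i + 2) * (\<beta> (i + 1) * u (i + 2))"
    using arg_cong[OF 2, of "(*) (\<beta> (i + 1))"] by (simp add: algebra_simps)
  then show ?case unfolding 1 by (simp add: algebra_simps numeral_2_eq_2)
next
  case (ge2 n)
  let ?K = "continuant \<alpha> (\<lambda>j. \<beta> j * \<gamma> j)" and ?P = "\<lambda>n. \<Prod>j = 1..n. \<beta> (i + int j)"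
  have P: "?P (Suc (Suc n)) = ?P (Suc n) * \<beta> (i + int n + 2)"
    "?P (Suc (Suc (Suc n))) = ?P (Suc (Suc n)) * \<beta> (i + int n + 3)"
    by (simp_all add: algebra_simps)
  have row: "\<beta> (i + int n + 3) * u (i + int n + 4)
      = - (\<gamma> (i + int n + 2) * u (i + int n + 2) + \<alpha> (i + int n + 3) * u (i + int n + 3))"
    using ge2.prems[of "i + int n + 3"] by (simp add: algebra_simps add_eq_0_iff)
  have IH1: "?K i (Suc n) * u (i + 1) + \<gamma> i * ?K (i + 1) n * u i
      = (-1) ^ Suc n * ?P (Suc n) * u (i + int n + 2)"
    using ge2.prems by (intro ge2.IH(1)) auto
  have IH2: "?K i (Suc (Suc n)) * u (i + 1) + \<gamma> i * ?K (i + 1) (Suc n) * u i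
      = (-1) ^ Suc (Suc n) * ?P (Suc (Suc n)) * u (i + int n + 3)"
    using ge2.IH(2) ge2.prems by (auto simp: algebra_simps simp del: continuant.simps prod.cl_ivl_Suc)
  \<comment> \<open>Both continuants on the left follow the same recursion at the last site, so
    their combination does too, and both induction hypotheses apply.\<close>
  have "?K i (Suc (Suc (Suc n))) * u (i + 1) + \<gamma> i * ?K (i + 1) (Suc (Suc n)) * u i
      = \<alpha> (i + int n + 3) * (?K i (Suc (Suc n)) * u (i + 1) + \<gamma> i * ?K (i + 1) (Suc n) * u i)
        - \<beta> (i + int n + 2) * \<gamma> (i + int n + 2) * (?K i (Suc n) * u (i + 1) + \<gamma> i * ?K (i + 1) n * u i)"
    unfolding continuant.simps(3)[of _ _ i "Suc n"] continuant.simps(3)[of _ _ "i + 1" n]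
    by (simp add: algebra_simps del: continuant.simps)
  also have "\<dots> = (-1) ^ Suc (Suc (Suc n)) * ?P (Suc (Suc n)) * (\<beta> (i + int n + 3) * u (i + int n + 4))"
    unfolding IH1 IH2 P(1) row by (simp add: algebra_simps del: prod.cl_ivl_Suc)
  finally show ?case
    unfolding P(2) by (simp add: algebra_simps del: continuant.simps prod.cl_ivl_Suc)
qed

lemma shift_invariant_const:
  fixes F :: "int \<Rightarrow> 'a"
  assumes "\<And>i. F (i + 1) = F i"
  shows "F i = F 0"
proof (induction i rule: int_induct[where k = 0])
  case (step2 i)
  then show ?case using assms[of "i - 1"] by simp
qed (simp_all add: assms)

text \<open>Moving the window by one site drops \<open>h (i + 1)\<close> and takes in
  \<open>h (i + 1 + int k)\<close>, which is equal.\<close>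

lemma periodic_prod_shift:
  fixes h :: "int \<Rightarrow> 'a::comm_monoid_mult"
  assumes "\<And>i. h (i + int k) = h i"
  shows "(\<Prod>j = 1..k. h (i + int j)) = (\<Prod>j = 1..k. h (int j))"
proof -
  have "(\<Prod>j = 1..k. h (i + 1 + int j)) = (\<Prod>j = 1..k. h (i + int j))" for i
  proof (cases k)
    case (Suc n)
    have "(\<Prod>j = 1..Suc n. h (i + 1 + int j)) = (\<Prod>j = 1..n. h (i + 1 + int j)) * h (i + 1)"
      using assms[of "i + 1"] Suc by (simp add: algebra_simps)
    also have "(\<Prod>j = 1..n. h (i + 1 + int j)) = (\<Prod>j = 2..Suc n. h (i + int j))"
      by (rule prod.reindex_bij_witness[where i = "\<lambda>j. j - 1" and j = Suc]) (auto simp: algebra_simps)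
    also have "\<dots> * h (i + 1) = (\<Prod>j = 1..Suc n. h (i + int j))"
      by (subst prod.atLeast_Suc_atMost[of 1]) (simp_all add: mult.commute numeral_2_eq_2)
    finally show ?thesis unfolding Suc .
  qed simp
  from shift_invariant_const[of "\<lambda>i. \<Prod>j = 1..k. h (i + int j)", OF this] show ?thesis by simp
qed

text \<open>The trace of the monodromy matrix does not depend on the site at which the period starts.\<close>

lemma continuant_trace_shift:
  assumes "\<And>i. \<alpha> (i + int n + 2) = \<alpha> i" and "\<And>i. \<delta> (i + int n + 2) = \<delta> i"
  shows "continuant \<alpha> \<delta> i (Suc (Suc n)) - \<delta> i * continuant \<alpha> \<delta> (i + 1) n =
    continuant \<alpha> \<delta> 0 (Suc (Suc n)) - \<delta> 0 * continuant \<alpha> \<delta> 1 n"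
proof -
  let ?K = "continuant \<alpha> \<delta>"
  have "?K (i + 1) (Suc (Suc n)) - \<delta> (i + 1) * ?K (i + 1 + 1) n = ?K i (Suc (Suc n)) - \<delta> i * ?K (i + 1) n" for i
  proof -
    \<comment> \<open>This continuant is expanded at its last site, whose coefficients are by
      periodicity those at \<open>i + 1\<close> and \<open>i\<close>; the one starting at
      \<open>i\<close> is then expanded at its first site, and the \<open>\<alpha>\<close> terms
      agree.\<close>
    have "?K (i + 1) (Suc (Suc n)) = \<alpha> (i + 1) * ?K (i + 1) (Suc n) - \<delta> i * ?K (i + 1) n"
      using assms(1)[of "i + 1"] assms(2)[of i] by (simp add: algebra_simps)
    then show ?thesis
      unfolding continuant_front[of _ _ i] by (simp add: algebra_simps)
  qed
  from shift_invariant_const[of "\<lambda>i. ?K i (Suc (Suc n)) - \<delta> i * ?K (i + 1) n", OF this]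
  show ?thesis by simp
qed

text \<open>Cayley-Hamilton for the monodromy matrix that takes \<open>u i\<close>,
  \<open>u (i + 1)\<close> one period further, with denominators cleared. Only rows strictly between
  \<open>i\<close> and \<open>i + 2 * int k\<close> enter, so a defect may sit at either end. For
  \<open>k = 1\<close> the relation is a single row.\<close>

lemma period_relation:
  fixes a b c :: "int \<Rightarrow> real" and u :: "int \<Rightarrow> complex"
  assumes "k \<ge> 1" and per: "\<And>i. a (i + int k) = a i" "\<And>i. b (i + int k) = b i" "\<And>i. c (i + int k) = c i"
    and B: "B = (- 1) ^ (k + 1) * (\<Prod>i = 1..k. b (int i))" "B \<noteq> 0"
    and rows: "\<And>j. i < j \<Longrightarrow> j < i + 2 * int k \<Longrightarrow>
      complex_of_real (c (j - 1)) * u (j - 1) + complex_of_real (a j - lam) * u j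
        + complex_of_real (b j) * u (j + 1) = 0"
  shows "complex_of_real B * u (i + 2 * int k) + complex_of_real (g_symbol k a b c lam) * u (i + int k)
    + complex_of_real (A_coeff k c) * u i = 0"
proof (cases "k = 1")
  case True
  have const: "f i = f 0" if "\<And>i. f (i + int k) = f i" for f :: "int \<Rightarrow> real" and i
    using that True by (intro shift_invariant_const) simp
  have "a (i + 1) = a 1" "b (i + 1) = b 1" "c i = c 1"
    using const[of a, OF per(1)] const[of b, OF per(2)] const[of c, OF per(3)] by metis+
  then show ?thesis
    using rows[of "i + 1"] True B by (simp add: g_symbol_1 A_coeff_def algebra_simps)
next
  case False
  with \<open>k \<ge> 1\<close> obtain n where k: "k = Suc (Suc n)"
    by (metis One_nat_def Suc_le_D not0_implies_Suc)
  let ?\<alpha> = "\<lambda>j. complex_of_real (a j - lam)" and ?\<beta> = "\<lambda>j. complex_of_real (b j)"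
    and ?\<gamma> = "\<lambda>j. complex_of_real (c j)"
  let ?K = "continuant ?\<alpha> (\<lambda>j. ?\<beta> j * ?\<gamma> j)"
  define M where "M = ?K i (Suc n)"
  define N where "N = ?K (i + 1) n"
  define L where "L = ?K (i + 1) (Suc n)"
  define K where "K = ?K i k"
  have perK: "?K (j + int k) l = ?K j l" for j l
    using per by (intro continuant_periodic) auto
  have prods: "(\<Prod>j = 1..k. h (int j)) = (\<Prod>j = 1..Suc n. h (i + int j)) * h i"
    if "\<And>i. h (i + int k) = h i" for h :: "int \<Rightarrow> complex"
    using periodic_prod_shift[of h k i, OF that] that[of i] unfolding k by (simp add: algebra_simps)
  have Bi: "complex_of_real B = (- 1) ^ Suc n * (\<Prod>j = 1..Suc n. ?\<beta> (i + int j)) * ?\<beta> i"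
    using prods[of ?\<beta>] per B unfolding k by (simp del: prod.cl_ivl_Suc)
  have Ai: "complex_of_real (A_coeff k c) = (- 1) ^ Suc n * (\<Prod>j = 1..Suc n. ?\<gamma> (i + int j)) * ?\<gamma> i"
    using prods[of ?\<gamma>] per unfolding k A_coeff_def by (simp del: prod.cl_ivl_Suc)
  \<comment> \<open>Second component of the monodromy, from the \<open>k\<close> rows after
    \<open>i\<close>.\<close>
  have T1: "K * u (i + 1) + ?\<gamma> i * L * u i = - complex_of_real B * u (i + int k + 1)"
  proof -
    have "K * u (i + 1) + ?\<gamma> i * L * u i
        = (-1) ^ Suc (Suc n) * (\<Prod>j = 1..Suc (Suc n). ?\<beta> (i + int j)) * u (i + int (Suc n) + 2)"
      unfolding K_def L_def k by (rule three_term_transfer) (use rows k in auto)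
    also have "(\<Prod>j = 1..Suc (Suc n). ?\<beta> (i + int j)) = (\<Prod>j = 1..Suc n. ?\<beta> (i + int j)) * ?\<beta> i"
      using prods[of ?\<beta>] periodic_prod_shift[of ?\<beta> k i] per unfolding k by simp
    finally show ?thesis unfolding Bi k by (simp add: algebra_simps del: prod.cl_ivl_Suc)
  qed
  \<comment> \<open>First component of the monodromy, from one row less; the factor
    \<open>?\<beta> i\<close> completes the product of the \<open>?\<beta>\<close> to
    \<open>B\<close>. By periodicity the same continuants serve both starting sites.\<close>
  have T2: "?\<beta> i * (M * u (l + 1) + ?\<gamma> i * N * u l) = complex_of_real B * u (l + int k)"
    if l: "l = i \<or> l = i + int k" for l
  proof -
    have "?K l (Suc n) * u (l + 1) + ?\<gamma> l * ?K (l + 1) n * u l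
        = (-1) ^ Suc n * (\<Prod>j = 1..Suc n. ?\<beta> (l + int j)) * u (l + int n + 2)"
      by (rule three_term_transfer) (use rows k l in auto)
    moreover have "?K l (Suc n) = M" "?\<gamma> l = ?\<gamma> i" "?K (l + 1) n = N"
      using l perK[of i "Suc n"] perK[of "i + 1" n] per unfolding M_def N_def by (auto simp: algebra_simps)
    moreover have "?\<beta> (l + int j) = ?\<beta> (i + int j)" for j
      using l per(2)[of "i + int j"] by (auto simp: algebra_simps)
    ultimately show ?thesis unfolding Bi k by (simp add: algebra_simps del: prod.cl_ivl_Suc)
  qed
  \<comment> \<open>The determinant \<open>A / B\<close> of the monodromy matrix, in cleared
    form.\<close>
  have cassini: "?\<beta> i * ?\<gamma> i * (M * L - K * N) = complex_of_real B * complex_of_real (A_coeff k c)"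
  proof -
    have "M * L - K * N = (\<Prod>j = 1..Suc n. ?\<beta> (i + int j) * ?\<gamma> (i + int j))"
      unfolding M_def L_def K_def N_def k by (rule continuant_cassini)
    moreover have "complex_of_real B * complex_of_real (A_coeff k c)
      = (\<Prod>j = 1..Suc n. ?\<beta> (i + int j)) * ?\<beta> i * ((\<Prod>j = 1..Suc n. ?\<gamma> (i + int j)) * ?\<gamma> i)"
    proof -
      have sq: "(-1) ^ Suc n * (-1) ^ Suc n = (1::complex)"
        by (simp flip: power_mult_distrib)
      have "(s * p * x) * (s * q * y) = (s * s) * (p * x * (q * y))" for s p q x y :: complex
        by (simp only: mult_ac)
      then show ?thesis unfolding Ai Bi by (simp only: sq mult_1_left)
    qed
    ultimately show ?thesis
      by (simp only: prod.distrib) (simp add: mult_ac del: prod.cl_ivl_Suc)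
  qed
  \<comment> \<open>The trace of the monodromy matrix, multiplied by \<open>- B\<close>. The
    starting site is moved to 0, where periodicity turns the coefficients at 0 into those at
    \<open>k\<close>.\<close>
  have G: "complex_of_real (g_symbol k a b c lam) = K - ?\<beta> i * ?\<gamma> i * N"
  proof -
    have "K - ?\<beta> i * ?\<gamma> i * N = ?K 0 k - ?\<beta> 0 * ?\<gamma> 0 * ?K 1 n"
      using continuant_trace_shift[of ?\<alpha> n "\<lambda>j. ?\<beta> j * ?\<gamma> j" i] per unfolding K_def N_def k
      by (simp add: algebra_simps del: continuant.simps)
    moreover have "b (int n + 2) = b 0" "c (int n + 2) = c 0"
      using per(2)[of 0] per(3)[of 0] unfolding k by (simp_all add: algebra_simps)
    ultimately show ?thesis
      unfolding k g_symbol_Suc_Suc by (simp add: of_real_continuant del: continuant.simps)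
  qed
  let ?B = "complex_of_real B" and ?A = "complex_of_real (A_coeff k c)"
  let ?v = "u (i + int k)" and ?w = "u (i + int k + 1)"
  \<comment> \<open>The relation times \<open>?B\<close>: first \<open>u (i + 2 * int k)\<close> is
    expressed one period back, then \<open>?v\<close> and \<open>?w\<close> by \<open>u i\<close>
    and \<open>u (i + 1)\<close>, where everything cancels.\<close>
  have "?B * (?B * u (i + 2 * int k) + (K - ?\<beta> i * ?\<gamma> i * N) * ?v + ?A * u i)
      = ?B * (?\<beta> i * (M * ?w + ?\<gamma> i * N * ?v)) + (K - ?\<beta> i * ?\<gamma> i * N) * (?B * ?v) + ?B * ?A * u i"
    using T2[of "i + int k"] by (simp add: algebra_simps)
  also have "\<dots> = - ?\<beta> i * M * (- ?B * ?w) + K * (?B * ?v) + ?B * ?A * u i"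
    by (simp add: algebra_simps)
  also have "\<dots> = - ?\<beta> i * M * (K * u (i + 1) + ?\<gamma> i * L * u i)
      + K * (?\<beta> i * (M * u (i + 1) + ?\<gamma> i * N * u i)) + ?\<beta> i * ?\<gamma> i * (M * L - K * N) * u i"
    using T2[of i] unfolding T1 cassini by simp
  also have "\<dots> = 0" by (simp add: algebra_simps)
  finally show ?thesis using B(2) G by simp
qed

section \<open>Decay\<close>

text \<open>Summability passes to an arithmetic progression, since its indexing is injective;
  negative \<open>s\<close> covers decay to the left.\<close>

lemma square_summable_tendsto_0:
  assumes "square_summable u" and "s \<noteq> 0"
  shows "(\<lambda>n. u (i + int n * s)) \<longlonglongrightarrow> 0"
proof -
  let ?h = "\<lambda>n. i + int n * s"
  have inj: "inj ?h" using \<open>s \<noteq> 0\<close> by (auto simp: inj_on_def)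
  have "(\<lambda>i. (cmod (u i))\<^sup>2) summable_on range ?h"
    using assms(1) unfolding square_summable_def by (rule summable_on_subset_banach) auto
  then have "summable (\<lambda>n. (cmod (u (?h n)))\<^sup>2)"
    using summable_on_reindex[OF inj, of "\<lambda>i. (cmod (u i))\<^sup>2"]
    by (intro summable_on_imp_summable) (simp add: o_def)
  then have "(\<lambda>n. sqrt ((cmod (u (?h n)))\<^sup>2)) \<longlonglongrightarrow> sqrt 0"
    by (intro tendsto_real_sqrt summable_LIMSEQ_zero)
  then show ?thesis by (simp add: tendsto_norm_zero_iff)
qed

text \<open>\<open>v (n + 1) - q * v n\<close> is geometric with ratio \<open>p\<close>, so it cannot tend to 0 unless it vanishes.\<close>

lemma decaying_recurrence:
  fixes v :: "nat \<Rightarrow> 'a::real_normed_field"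
  assumes rec: "\<And>n. v (Suc (Suc n)) = (p + q) * v (Suc n) - p * q * v n"
    and "norm p \<ge> 1" and lim: "v \<longlonglongrightarrow> 0"
  shows "v 1 = q * v 0"
proof -
  define w where "w n = v (Suc n) - q * v n" for n
  have w: "w n = p ^ n * w 0" for n
  proof (induction n)
    case (Suc n)
    have "w (Suc n) = p * w n" unfolding w_def rec by (simp add: algebra_simps)
    then show ?case using Suc by simp
  qed simp
  have "norm (w n) \<ge> norm (w 0)" for n
    using \<open>norm p \<ge> 1\<close> mult_right_mono[of 1 "norm p ^ n" "norm (w 0)"]
    unfolding w[of n] by (simp add: norm_mult norm_power one_le_power)
  moreover have "(\<lambda>n. norm (w n)) \<longlonglongrightarrow> norm (0 - q * 0 :: 'a)"
    unfolding w_def by (intro tendsto_intros LIMSEQ_Suc lim)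
  ultimately have "norm (w 0) \<le> 0"
    by (intro LIMSEQ_le_const[of "\<lambda>n. norm (w n)"]) auto
  then show ?thesis by (simp add: w_def)
qed

section \<open>The roots of the characteristic quadratic\<close>

lemma Re_Arccosh_of_real:
  assumes "\<bar>x\<bar> \<ge> 1"
  shows "Re (Arccosh (complex_of_real x)) = arcosh \<bar>x\<bar>"
proof (cases "x \<ge> 0")
  case True
  then show ?thesis using assms Arccosh_of_real[of x] by simp
next
  case False
  then show ?thesis using assms Arccosh_of_real_neg[of "- x"] by simp
qed

text \<open>The last two conclusions are Vieta's formulas for \<open>B * t^2 + g * t + A\<close>:
  the roots have geometric mean \<open>exp (- r)\<close> in modulus, and \<open>\<beta>\<close>
  measures how far they lie apart.\<close>

lemma quadratic_roots_arccosh: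
  fixes A B g r :: real
  defines "\<beta> \<equiv> Re (Arccosh (complex_of_real (- (g / (2 * A * exp r)))))"
  assumes "A \<noteq> 0" "r > 0" and B: "B = A * exp (2 * r)" and g: "\<bar>A + B\<bar> \<le> \<bar>g\<bar>"
  obtains \<sigma> :: real where "\<bar>\<sigma>\<bar> = 1" "r \<le> \<beta>"
    "B * (\<sigma> * exp (- (r - \<beta>)) + \<sigma> * exp (- (r + \<beta>))) = - g"
    "B * ((\<sigma> * exp (- (r - \<beta>))) * (\<sigma> * exp (- (r + \<beta>)))) = A"
proof
  define x where "x = - (g / (2 * A * exp r))"
  \<comment> \<open>The eigenvalues of the monodromy are real, both with the sign of \<open>x\<close>, the argument of arccosh.\<close>
  define \<sigma> :: real where "\<sigma> = (if x \<ge> 0 then 1 else - 1)"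
  \<comment> \<open>This turns the bound on \<open>g\<close> into
    \<open>cosh r \<le> \<bar>x\<bar>\<close>, which is \<open>r \<le> \<beta>\<close> because
    \<open>\<bar>x\<bar> = cosh \<beta>\<close>.\<close>
  have AB: "A + B = A * exp r * (2 * cosh r)"
    unfolding B cosh_def by (simp add: algebra_simps exp_minus flip: exp_add)
  have pos: "2 * \<bar>A\<bar> * exp r > 0"
    using \<open>A \<noteq> 0\<close> by simp
  have "cosh r * (2 * \<bar>A\<bar> * exp r) \<le> \<bar>g\<bar>"
    using g unfolding AB by (simp add: abs_mult mult_ac)
  moreover have "\<bar>x\<bar> = \<bar>g\<bar> / (2 * \<bar>A\<bar> * exp r)"
    unfolding x_def by (simp add: abs_mult)
  ultimately have x: "cosh r \<le> \<bar>x\<bar>"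
    using pos by (simp only: pos_le_divide_eq)
  then have x1: "\<bar>x\<bar> \<ge> 1"
    using cosh_real_ge_1[of r] by linarith
  then have \<beta>: "\<beta> = arcosh \<bar>x\<bar>"
    unfolding \<beta>_def x_def[symmetric] by (rule Re_Arccosh_of_real)
  then have cosh: "cosh \<beta> = \<bar>x\<bar>" and "\<beta> \<ge> 0"
    using x1 by simp_all
  show "r \<le> \<beta>"
    using cosh_real_nonneg_le_iff[of r \<beta>] cosh x \<open>\<beta> \<ge> 0\<close> \<open>r > 0\<close> by simp
  show "\<bar>\<sigma>\<bar> = 1" by (simp add: \<sigma>_def)
  have \<sigma>x: "\<sigma> * \<bar>x\<bar> = x" by (simp add: \<sigma>_def)
  have "exp (- (r - \<beta>)) + exp (- (r + \<beta>)) = exp (- r) * (2 * cosh \<beta>)"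
    unfolding cosh_def by (simp add: algebra_simps flip: exp_add)
  then have "B * (\<sigma> * exp (- (r - \<beta>)) + \<sigma> * exp (- (r + \<beta>))) = B * exp (- r) * 2 * (\<sigma> * cosh \<beta>)"
    unfolding distrib_left[symmetric] by (simp only: mult_ac)
  also have "B * exp (- r) = A * exp r"
    unfolding B by (simp add: algebra_simps flip: exp_add)
  also have "\<sigma> * cosh \<beta> = x" using \<sigma>x cosh by simp
  also have "A * exp r * 2 * x = - g"
    using \<open>A \<noteq> 0\<close> by (simp add: x_def)
  finally show "B * (\<sigma> * exp (- (r - \<beta>)) + \<sigma> * exp (- (r + \<beta>))) = - g" .
  have "\<sigma> * \<sigma> = 1" by (simp add: \<sigma>_def)
  then have "B * ((\<sigma> * exp (- (r - \<beta>))) * (\<sigma> * exp (- (r + \<beta>)))) = B * (exp (- (r - \<beta>)) * exp (- (r + \<beta>)))"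
    by (simp add: algebra_simps)
  also have "\<dots> = A" unfolding B by (simp add: algebra_simps flip: exp_add)
  finally show "B * ((\<sigma> * exp (- (r - \<beta>))) * (\<sigma> * exp (- (r + \<beta>)))) = A" .
qed

lemma laurent_row_sum:
  "(\<Sum>\<^sub>\<infinity>j. complex_of_real (laurent a b c i j) * u j)
    = complex_of_real (c (i - 1)) * u (i - 1) + complex_of_real (a i) * u i + complex_of_real (b i) * u (i + 1)"
proof -
  have "(\<Sum>\<^sub>\<infinity>j. complex_of_real (laurent a b c i j) * u j)
      = (\<Sum>\<^sub>\<infinity>j\<in>{i - 1, i, i + 1}. complex_of_real (laurent a b c i j) * u j)"
    by (rule infsum_cong_neutral) (auto simp: laurent_def)
  then show ?thesis by (simp add: laurent_def add.assoc)
qed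

theorem corollary2p9:
  fixes k :: nat and a b c :: "int \<Rightarrow> real" and m :: int
    and d u :: "int \<Rightarrow> complex" and lam :: real
  assumes "k \<ge> 1"
    and "\<And>i. a (i + int k) = a i"
    and "\<And>i. b (i + int k) = b i"
    and "\<And>i. c (i + int k) = c i"
    and "\<And>i. 1 \<le> i \<Longrightarrow> i \<le> int k \<Longrightarrow> b i * c i > 0"
    and "(\<Prod>i = 1..k. b (int i) / c (int i)) > 1"
    and "square_summable d"
    and "lam \<in> - sigma_wind k a b c"
    and "is_eigenvector (defected_laurent a b c m d) u (complex_of_real lam)"
  shows "(\<forall>i. i + int k \<le> m \<longrightarrow>
            (u i = 0 \<longrightarrow> u (i + int k) = 0) \<and>
            (u i \<noteq> 0 \<longrightarrow> cmod (u (i + int k)) / cmod (u i)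
               = exp (- (decay_r k b c - beta_tilde k a b c lam)))) \<and>
         (\<forall>i. i \<ge> m \<longrightarrow>
            (u i = 0 \<longrightarrow> u (i + int k) = 0) \<and>
            (u i \<noteq> 0 \<longrightarrow> cmod (u (i + int k)) / cmod (u i)
               = exp (- (decay_r k b c + beta_tilde k a b c lam))))"
proof -
  define A where "A = A_coeff k c"
  define B where "B = (- 1) ^ (k + 1) * (\<Prod>i = 1..k. b (int i))"
  define g where "g = g_symbol k a b c lam"
  define r where "r = decay_r k b c"
  define \<beta> where "\<beta> = beta_tilde k a b c lam"
  have bc: "b (int i) * c (int i) > 0" if "i \<in> {1..k}" for i
    using assms(5)[of "int i"] that by auto
  have cnz: "c (int i) \<noteq> 0" if "i \<in> {1..k}" for i
    using bc[OF that] by auto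
  have quotient: "(\<Prod>i = 1..k. b (int i) / c (int i)) = exp (2 * r)"
    using assms(6) by (simp add: r_def decay_r_def)
  have "A \<noteq> 0"
    using cnz by (auto simp: A_def A_coeff_def)
  \<comment> \<open>The sign \<open>(- 1) ^ (k + 1)\<close> is common to both, so
    \<open>B / A\<close> is the product of the quotients of \<open>b\<close> by
    \<open>c\<close>.\<close>
  have BA: "B = A * exp (2 * r)"
    using cnz unfolding quotient[symmetric] A_def B_def A_coeff_def by (simp add: prod_dividef)
  have "r > 0"
    using assms(6) by (simp add: r_def decay_r_def)
  have AB: "A * B > 0" "\<bar>A\<bar> < \<bar>B\<bar>"
  proof -
    have "A * A > 0" using \<open>A \<noteq> 0\<close> by (simp add: zero_less_mult_iff linorder_neq_iff disj_commute)
    then show "A * B > 0" unfolding BA by (simp add: mult.assoc[symmetric])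
    show "\<bar>A\<bar> < \<bar>B\<bar>" unfolding BA using \<open>A \<noteq> 0\<close> \<open>r > 0\<close> by (simp add: abs_mult)
  qed
  then have "B \<noteq> 0" by auto
  have g_ge: "\<bar>A + B\<bar> \<le> \<bar>g\<bar>"
    using g_symbol_ge_outside_winding[OF assms(1) _ B_def] AB assms(8) by (simp add: A_def g_def)
  obtain \<sigma> :: real where "\<bar>\<sigma>\<bar> = 1" "r \<le> \<beta>"
    and roots: "B * (\<sigma> * exp (- (r - \<beta>)) + \<sigma> * exp (- (r + \<beta>))) = - g"
    "B * ((\<sigma> * exp (- (r - \<beta>))) * (\<sigma> * exp (- (r + \<beta>)))) = A"
    using quadratic_roots_arccosh[OF \<open>A \<noteq> 0\<close> \<open>r > 0\<close> BA g_ge]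
    unfolding \<beta>_def beta_tilde_def A_def g_def r_def by metis
  \<comment> \<open>The eigenvalues of the monodromy matrix: \<open>p\<close> has modulus at least 1
    and \<open>q\<close> less than 1.\<close>
  define p q where "p = complex_of_real (\<sigma> * exp (- (r - \<beta>)))"
    and "q = complex_of_real (\<sigma> * exp (- (r + \<beta>)))"
  have norm_p: "cmod p = exp (- (r - \<beta>))" and norm_q: "cmod q = exp (- (r + \<beta>))"
    unfolding p_def q_def norm_of_real abs_mult \<open>\<bar>\<sigma>\<bar> = 1\<close> by simp_all
  have "p \<noteq> 0" "q \<noteq> 0" using norm_p norm_q by auto
  have g_pq: "complex_of_real g = - complex_of_real B * (p + q)"
    and A_pq: "complex_of_real A = complex_of_real B * (p * q)"
    using roots by (simp_all add: p_def q_def flip: of_real_add of_real_mult of_real_minus)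
  have row: "complex_of_real (c (j - 1)) * u (j - 1) + complex_of_real (a j - lam) * u j
      + complex_of_real (b j) * u (j + 1) = 0" if "j \<noteq> m" for j
  proof -
    have "(\<Sum>\<^sub>\<infinity>l. complex_of_real (laurent a b c j l) * u l) = complex_of_real lam * u j"
      using assms(9) that unfolding is_eigenvector_def defected_laurent_def by (auto dest: spec[of _ j])
    then show ?thesis unfolding laurent_row_sum by (simp add: algebra_simps)
  qed
  \<comment> \<open>Under the stated condition \<open>m\<close> is not strictly between
    \<open>i\<close> and \<open>i + 2 * int k\<close>, so every row involved is one of the pristine
    operator.\<close>
  have rel: "u (i + 2 * int k) - (p + q) * u (i + int k) + p * q * u i = 0"
    if "m \<le> i \<or> i + 2 * int k \<le> m" for i
  proof -
    have "complex_of_real B * u (i + 2 * int k) + complex_of_real g * u (i + int k) + complex_of_real A * u i = 0"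
      unfolding g_def A_def using that
      by (intro period_relation[where k = k and a = a and b = b and c = c, OF assms(1-4) B_def \<open>B \<noteq> 0\<close>] row) auto
    then have "complex_of_real B * (u (i + 2 * int k) - (p + q) * u (i + int k) + p * q * u i) = 0"
      unfolding g_pq A_pq by (simp add: algebra_simps)
    then show ?thesis using \<open>B \<noteq> 0\<close> by simp
  qed
  have summable: "square_summable u" using assms(9) by (simp add: is_eigenvector_def)
  \<comment> \<open>Running leftwards, the recurrence has the inverse eigenvalues.\<close>
  have left: "u (i + int k) = p * u i" if "i + int k \<le> m" for i
  proof -
    \<comment> \<open>The sequence starts at the right end, so \<open>v 0\<close> is
      \<open>u (i + int k)\<close> and \<open>v 1\<close> is \<open>u i\<close>.\<close>
    define v where "v n = u (i + int k + int n * (- int k))" for n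
    have "v 1 = inverse p * v 0"
    proof (rule decaying_recurrence)
      \<comment> \<open>The excluded eigenvalue is \<open>inverse q\<close>, of modulus
        \<open>exp (r + \<beta>)\<close>; what remains is \<open>inverse p\<close>.\<close>
      show "v (Suc (Suc n)) = (inverse q + inverse p) * v (Suc n) - inverse q * inverse p * v n" for n
      proof -
        have "i + int k - int (Suc (Suc n)) * int k + 2 * int k \<le> m"
          using that by (simp add: algebra_simps) (smt (verit) mult_nonneg_nonneg of_nat_0_le_iff)
        from rel[OF disjI2, OF this] have v: "v n = (p + q) * v (Suc n) - p * q * v (Suc (Suc n))"
          unfolding v_def by (simp add: algebra_simps)
        show ?thesis
          unfolding v using \<open>p \<noteq> 0\<close> \<open>q \<noteq> 0\<close> by (simp add: field_simps)
      qed
      show "norm (inverse q) \<ge> 1"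
        using \<open>r > 0\<close> \<open>r \<le> \<beta>\<close> by (simp add: norm_inverse norm_q flip: exp_minus)
      show "v \<longlonglongrightarrow> 0"
        unfolding v_def using summable assms(1) by (intro square_summable_tendsto_0) auto
    qed
    then show ?thesis
      using \<open>p \<noteq> 0\<close> by (simp add: v_def field_simps)
  qed
  have right: "u (i + int k) = q * u i" if "m \<le> i" for i
  proof -
    define v where "v n = u (i + int n * int k)" for n
    have "v 1 = q * v 0"
    proof (rule decaying_recurrence)
      show "v (Suc (Suc n)) = (p + q) * v (Suc n) - p * q * v n" for n
      proof -
        have "m \<le> i + int n * int k" using that by (simp add: add_increasing2)
        from rel[OF disjI1, OF this] show ?thesis
          unfolding v_def by (simp add: algebra_simps)
      qed
      \<comment> \<open>To the right, being outside the winding region excludes \<open>p\<close>: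
        the bound \<open>r \<le> \<beta>\<close> keeps its modulus from falling below 1.\<close>
      show "norm p \<ge> 1" using \<open>r \<le> \<beta>\<close> by (simp add: norm_p)
      show "v \<longlonglongrightarrow> 0"
        unfolding v_def using summable assms(1) by (intro square_summable_tendsto_0) auto
    qed
    then show ?thesis by (simp add: v_def)
  qed
  show ?thesis
    using left right by (auto simp: norm_mult norm_p norm_q r_def \<beta>_def)
qed

end
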